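(* Let $(X,\rho,\mu)$ be a space of homogeneous type such that $\mu$ is Borel regular, and let $\mathscr D$ be a fixed system of dyadic cubes in $X$. Suppose $w$ is a weight on $X$ and $w\in RH_q^{\mathscr D}(X)$ for some $q\in(1,\infty)$. Then $w\in A_p^{\mathscr D}(X)$ for some $p\in(1,\infty)$.
   Context: A quasimetric on a set $X$ is a function $\rho:X\times X\to[0,\infty)$ with $\rho(x,y)=0$ iff $x=y$, $\rho(x,y)=\rho(y,x)$, and $\rho(x,z)\le A_0\rho(x,y)+A_0\rho(y,z)$ for all $x,y,z$, with $A_0\ge1$ a constant. $B(x,r)=\{y:\rho(x,y)<r\}$; a set $O$ is open if each $x\in O$ has a ball $B(x,r)\subset O$. A measure $\mu$ is doubling if balls are $\mu$-measurable and there is $A_1\ge1$ with $0<\mu(B(x,2r))\le A_1\mu(B(x,r))<\infty$ for all $x\in X$, $r>0$. A space of homogeneous type is a triple $(X,\rho,\mu)$ with $X$ nonempty, $\rho$ a quasimetric, $\mu$ doubling; $\mu$ is defined on a $\sigma$-algebra containing all Borel sets and all balls. $\mu$ is Borel regular if for all Borel sets $E$, $\mu(E)=\sup\{\mu(V):V\text{ closed},V\subset E\}=\inf\{\mu(U):U\text{ open},E\subset U\}$. A system of dyadic cubes with parameters $\delta\in(0,1)$ and $0<c_1<C_1<\infty$ is a countable family $\mathscr D=\bigcup_{k\in\mathbb Z}\mathscr D_k$, $\mathscr D_k=\{Q^k_\beta:\beta\in\mathscr A_k\}$, of Borel sets $Q^k_\beta\subset X$ with points $x^k_\beta\in Q^k_\beta$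 such that: (1) for each $k$, $X$ is the disjoint union of the $Q^k_\beta$, $\beta\in\mathscr A_k$; (2) if $l\ge k$, then either $Q^l_\gamma\subset Q^k_\beta$ or $Q^k_\beta\cap Q^l_\gamma=\emptyset$; (3) $B(x^k_\beta,c_1\delta^k)\subset Q^k_\beta\subset B(x^k_\beta,C_1\delta^k)=:B(Q^k_\beta)$; (4) if $l\ge k$ and $Q^l_\gamma\subset Q^k_\beta$ then $B(Q^l_\gamma)\subset B(Q^k_\beta)$; (5) for each $(k,\beta)$ and each $l\le k$ there is a unique $\gamma$ with $Q^k_\beta\subset Q^l_\gamma$; (6) for each $(k,\beta)$ there are between $1$ and $M_0$ (a fixed constant) cubes $Q^{k+1}_\gamma\subset Q^k_\beta$ (the children of $Q^k_\beta$), and $Q^k_\beta$ is their union. Convention: the fixed system $\mathscr D$ is one of the members of a collection $\{\mathscr D^t:t=1,\dots,T\}$ of adjacent systems of dyadic cubes on $X$, with parameters $0<\delta\le(96A_0^6)^{-1}$, $c_1=(12A_0^4)^{-1}$, $C_1=4A_0^2$; adjacency means that for each ball $B(x,r)$ with $\delta^{k+3}<r<\delta^{k+2}$ there are $t$ and a cube $Q\in\mathscr D^t$ of generation $k$ with center point $z$ such that $\rho(x,z)<2A_0\delta^k$ and $B(x,r)\subset Q\subset B(x,8A_0^3\delta^{-3}r)$. A weight is a nonnegative locally integrable function $w:X\to[0,\infty]$; $w(E)=\int_Ew\,d\mu$. $w$ is dyadic doubling (w.r.t. $\mathscr D$) if there is a constant $C$ such that $0<w(Q)\le Cw(Q')<\infty$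 for every $Q\in\mathscr D$ and each child $Q'$ of $Q$. For $1<q<\infty$, $w\in RH_q^{\mathscr D}(X)$ means that $w$ is dyadic doubling and $$\sup_{Q\in\mathscr D}\Big(\frac1{\mu(Q)}\int_Qw^q\,d\mu\Big)^{1/q}\Big(\frac1{\mu(Q)}\int_Qw\,d\mu\Big)^{-1}<\infty.$$ For $1<p<\infty$, $w\in A_p^{\mathscr D}(X)$ means $$\sup_{Q\in\mathscr D}\Big(\frac1{\mu(Q)}\int_Qw\,d\mu\Big)\Big(\frac1{\mu(Q)}\int_Q\Big(\frac1w\Big)^{1/(p-1)}d\mu\Big)^{p-1}<\infty.$$
   Formalization: The weight w is additionally assumed to agree μ-almost everywhere with a Borel function (automatic if μ lives on the Borel sets or their completion); without this the claim fails on larger σ-algebras. *)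

theory Defs
  imports "HOL-Analysis.Analysis"
begin

section \<open>Spaces of homogeneous type\<close>

text \<open>The space \<open>X\<close> is the carrier \<open>space M\<close> of the measure \<open>M\<close>. The constant \<open>A0\<close> of the
  quasi-triangle inequality is a parameter, since it enters the parameters of the dyadic systems.\<close>

definition quasimetric_on :: "'a set \<Rightarrow> ('a \<Rightarrow> 'a \<Rightarrow> real) \<Rightarrow> real \<Rightarrow> bool" where
  "quasimetric_on X \<rho> A0 \<longleftrightarrow> A0 \<ge> 1 \<and>
     (\<forall>x\<in>X. \<forall>y\<in>X. \<rho> x y \<ge> 0 \<and> (\<rho> x y = 0 \<longleftrightarrow> x = y) \<and> \<rho> x y = \<rho> y x) \<and>
     (\<forall>x\<in>X. \<forall>y\<in>X. \<forall>z\<in>X. \<rho> x z \<le> A0 * \<rho> x y + A0 * \<rho> y z)"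

definition qball :: "'a set \<Rightarrow> ('a \<Rightarrow> 'a \<Rightarrow> real) \<Rightarrow> 'a \<Rightarrow> real \<Rightarrow> 'a set" where
  "qball X \<rho> x r = {y \<in> X. \<rho> x y < r}"

text \<open>Quasimetric balls need not be open in this topology.\<close>

definition qtopology :: "'a set \<Rightarrow> ('a \<Rightarrow> 'a \<Rightarrow> real) \<Rightarrow> 'a topology" where
  "qtopology X \<rho> = topology (\<lambda>U. U \<subseteq> X \<and> (\<forall>x\<in>U. \<exists>r>0. qball X \<rho> x r \<subseteq> U))"

lemma openin_qtopology:
  "openin (qtopology X \<rho>) U \<longleftrightarrow> U \<subseteq> X \<and> (\<forall>x\<in>U. \<exists>r>0. qball X \<rho> x r \<subseteq> U)"
proof -
  let ?P = "\<lambda>U. U \<subseteq> X \<and> (\<forall>x\<in>U. \<exists>r>0. qball X \<rho> x r \<subseteq> U)"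
  have "istopology ?P"
    unfolding istopology_def
  proof (rule conjI)
    show "\<forall>S T. ?P S \<longrightarrow> ?P T \<longrightarrow> ?P (S \<inter> T)"
    proof (intro allI impI)
      fix S T assume S: "?P S" and T: "?P T"
      have "\<exists>r>0. qball X \<rho> x r \<subseteq> S \<inter> T" if x: "x \<in> S \<inter> T" for x
      proof -
        from S x obtain r where r: "r > 0" "qball X \<rho> x r \<subseteq> S" by (meson IntD1)
        from T x obtain s where s: "s > 0" "qball X \<rho> x s \<subseteq> T" by (meson IntD2)
        have "qball X \<rho> x (min r s) \<subseteq> qball X \<rho> x r \<inter> qball X \<rho> x s"
          by (simp add: qball_def subset_iff)
        also have "\<dots> \<subseteq> S \<inter> T" using r(2) s(2) by (rule Int_mono)
        finally have "qball X \<rho> x (min r s) \<subseteq> S \<inter> T" .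
        moreover have "min r s > 0" using r(1) s(1) by simp
        ultimately show ?thesis by (intro exI conjI)
      qed
      moreover have "S \<inter> T \<subseteq> X" using S by (simp add: le_infI1)
      ultimately show "?P (S \<inter> T)" by simp
    qed
    show "\<forall>\<K>. (\<forall>K\<in>\<K>. ?P K) \<longrightarrow> ?P (\<Union> \<K>)"
    proof (intro allI impI)
      fix \<K> assume K: "\<forall>K\<in>\<K>. ?P K"
      have "\<exists>r>0. qball X \<rho> x r \<subseteq> \<Union> \<K>" if x: "x \<in> \<Union> \<K>" for x
      proof -
        from x obtain U where U: "U \<in> \<K>" "x \<in> U" by (rule UnionE)
        with K obtain r where "r > 0" "qball X \<rho> x r \<subseteq> U" by meson
        with U(1) show ?thesis by (meson Union_upper subset_trans)
      qed
      moreover have "\<Union> \<K> \<subseteq> X" using K by (simp add: Sup_le_iff)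
      ultimately show "?P (\<Union> \<K>)" by simp
    qed
  qed
  then show ?thesis by (simp add: qtopology_def topology_inverse')
qed

lemma topspace_qtopology: "topspace (qtopology X \<rho>) = X"
proof (rule antisym)
  have "openin (qtopology X \<rho>) (topspace (qtopology X \<rho>))" by simp
  then show "topspace (qtopology X \<rho>) \<subseteq> X"
    unfolding openin_qtopology by (rule conjunct1)
  have "openin (qtopology X \<rho>) X"
    unfolding openin_qtopology
  proof (intro conjI ballI)
    fix x assume "x \<in> X"
    show "\<exists>r>0. qball X \<rho> x r \<subseteq> X"
      by (rule exI[of _ 1]) (simp add: qball_def)
  qed simp
  then show "X \<subseteq> topspace (qtopology X \<rho>)" by (rule openin_subset)
qed

definition qborel :: "'a set \<Rightarrow> ('a \<Rightarrow> 'a \<Rightarrow> real) \<Rightarrow> 'a measure" where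
  "qborel X \<rho> = sigma X {U. openin (qtopology X \<rho>) U}"

definition doubling_measure :: "'a measure \<Rightarrow> ('a \<Rightarrow> 'a \<Rightarrow> real) \<Rightarrow> bool" where
  "doubling_measure M \<rho> \<longleftrightarrow>
     (\<forall>x\<in>space M. \<forall>r>0. qball (space M) \<rho> x r \<in> sets M) \<and>
     (\<exists>A1::real. A1 \<ge> 1 \<and> (\<forall>x\<in>space M. \<forall>r>0.
        0 < emeasure M (qball (space M) \<rho> x (2 * r)) \<and>
        emeasure M (qball (space M) \<rho> x (2 * r)) \<le> ennreal A1 * emeasure M (qball (space M) \<rho> x r) \<and>
        ennreal A1 * emeasure M (qball (space M) \<rho> x r) < \<infinity>))"

definition homogeneous_type :: "'a measure \<Rightarrow> ('a \<Rightarrow> 'a \<Rightarrow> real) \<Rightarrow> real \<Rightarrow> bool" where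
  "homogeneous_type M \<rho> A0 \<longleftrightarrow>
     space M \<noteq> {} \<and> quasimetric_on (space M) \<rho> A0 \<and>
     sets (qborel (space M) \<rho>) \<subseteq> sets M \<and> doubling_measure M \<rho>"

definition borel_regular :: "'a measure \<Rightarrow> ('a \<Rightarrow> 'a \<Rightarrow> real) \<Rightarrow> bool" where
  "borel_regular M \<rho> \<longleftrightarrow> (\<forall>E\<in>sets (qborel (space M) \<rho>).
     emeasure M E = (SUP V\<in>{V. closedin (qtopology (space M) \<rho>) V \<and> V \<subseteq> E}. emeasure M V) \<and>
     emeasure M E = (INF U\<in>{U. openin (qtopology (space M) \<rho>) U \<and> E \<subseteq> U}. emeasure M U))"

section \<open>Systems of dyadic cubes\<close>

text \<open>Cubes are indexed by generation and index, because the same set can be a cube of several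
  generations.\<close>

record ('a, 'i) cube_family =
  idx :: "int \<Rightarrow> 'i set"
  cube :: "int \<Rightarrow> 'i \<Rightarrow> 'a set"
  center :: "int \<Rightarrow> 'i \<Rightarrow> 'a"

definition children :: "('a, 'i) cube_family \<Rightarrow> int \<Rightarrow> 'i \<Rightarrow> 'i set" where
  "children D k \<beta> = {\<gamma> \<in> idx D (k + 1). cube D (k + 1) \<gamma> \<subseteq> cube D k \<beta>}"

definition cube_ball ::
    "'a set \<Rightarrow> ('a \<Rightarrow> 'a \<Rightarrow> real) \<Rightarrow> real \<Rightarrow> real \<Rightarrow> ('a, 'i) cube_family \<Rightarrow> int \<Rightarrow> 'i \<Rightarrow> 'a set" where
  "cube_ball X \<rho> \<delta> C1 D k \<beta> = qball X \<rho> (center D k \<beta>) (C1 * \<delta> powi k)"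

definition dyadic_system ::
    "'a set \<Rightarrow> ('a \<Rightarrow> 'a \<Rightarrow> real) \<Rightarrow> real \<Rightarrow> real \<Rightarrow> real \<Rightarrow> ('a, 'i) cube_family \<Rightarrow> bool" where
  "dyadic_system X \<rho> \<delta> c1 C1 D \<longleftrightarrow>
     0 < \<delta> \<and> \<delta> < 1 \<and> 0 < c1 \<and> c1 < C1 \<and>
     (\<forall>k. countable (idx D k)) \<and>
     (\<forall>k. \<forall>\<beta>\<in>idx D k. cube D k \<beta> \<in> sets (qborel X \<rho>) \<and> center D k \<beta> \<in> cube D k \<beta>) \<and>
     (\<forall>k. (\<Union>\<beta>\<in>idx D k. cube D k \<beta>) = X \<and> disjoint_family_on (cube D k) (idx D k)) \<and>
     (\<forall>k l. \<forall>\<beta>\<in>idx D k. \<forall>\<gamma>\<in>idx D l. k \<le> l \<longrightarrow>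
        cube D l \<gamma> \<subseteq> cube D k \<beta> \<or> cube D k \<beta> \<inter> cube D l \<gamma> = {}) \<and>
     (\<forall>k. \<forall>\<beta>\<in>idx D k. qball X \<rho> (center D k \<beta>) (c1 * \<delta> powi k) \<subseteq> cube D k \<beta> \<and>
        cube D k \<beta> \<subseteq> cube_ball X \<rho> \<delta> C1 D k \<beta>) \<and>
     (\<forall>k l. \<forall>\<beta>\<in>idx D k. \<forall>\<gamma>\<in>idx D l. k \<le> l \<longrightarrow> cube D l \<gamma> \<subseteq> cube D k \<beta> \<longrightarrow>
        cube_ball X \<rho> \<delta> C1 D l \<gamma> \<subseteq> cube_ball X \<rho> \<delta> C1 D k \<beta>) \<and>
     (\<forall>k l. \<forall>\<beta>\<in>idx D k. l \<le> k \<longrightarrow> (\<exists>!\<gamma>. \<gamma> \<in> idx D l \<and> cube D k \<beta> \<subseteq> cube D l \<gamma>)) \<and>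
     (\<exists>M0::nat. \<forall>k. \<forall>\<beta>\<in>idx D k. finite (children D k \<beta>) \<and>
        1 \<le> card (children D k \<beta>) \<and> card (children D k \<beta>) \<le> M0 \<and>
        cube D k \<beta> = (\<Union>\<gamma>\<in>children D k \<beta>. cube D (k + 1) \<gamma>))"

definition adjacent_dyadic_systems ::
    "'a set \<Rightarrow> ('a \<Rightarrow> 'a \<Rightarrow> real) \<Rightarrow> real \<Rightarrow> real \<Rightarrow> nat \<Rightarrow> (nat \<Rightarrow> ('a, 'i) cube_family) \<Rightarrow> bool" where
  "adjacent_dyadic_systems X \<rho> A0 \<delta> T Ds \<longleftrightarrow>
     0 < \<delta> \<and> \<delta> \<le> 1 / (96 * A0 ^ 6) \<and>
     (\<forall>t\<in>{1..T}. dyadic_system X \<rho> \<delta> (1 / (12 * A0 ^ 4)) (4 * A0\<^sup>2) (Ds t)) \<and>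
     (\<forall>x\<in>X. \<forall>r k. \<delta> powi (k + 3) < r \<and> r < \<delta> powi (k + 2) \<longrightarrow>
        (\<exists>t\<in>{1..T}. \<exists>\<beta>\<in>idx (Ds t) k.
           \<rho> x (center (Ds t) k \<beta>) < 2 * A0 * \<delta> powi k \<and>
           qball X \<rho> x r \<subseteq> cube (Ds t) k \<beta> \<and>
           cube (Ds t) k \<beta> \<subseteq> qball X \<rho> x (8 * A0 ^ 3 * \<delta> powi (- 3) * r)))"

section \<open>Weights\<close>

text \<open>Local integrability means integrability on balls. As usual, measurable functions are Borel
  measurable up to null sets. This has to be said explicitly: the \<open>\<sigma>\<close>-algebra of \<open>M\<close> may be
  strictly larger than the completion of the Borel one (Borel regularity only constrains Borel
  sets), and for merely \<open>M\<close>-measurable functions Lebesgue differentiation fails.\<close>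

definition weight :: "'a measure \<Rightarrow> ('a \<Rightarrow> 'a \<Rightarrow> real) \<Rightarrow> ('a \<Rightarrow> ennreal) \<Rightarrow> bool" where
  "weight M \<rho> w \<longleftrightarrow>
     w \<in> borel_measurable M \<and>
     (\<exists>g\<in>borel_measurable (qborel (space M) \<rho>). AE x in M. w x = g x) \<and>
     (\<forall>x\<in>space M. \<forall>r>0. (\<integral>\<^sup>+ y\<in>qball (space M) \<rho> x r. w y \<partial>M) < \<infinity>)"

text \<open>Power of an extended nonnegative real, for exponents \<open>a > 0\<close> only (so \<open>\<infinity>\<close> goes to \<open>\<infinity>\<close>
  and \<open>0\<close> to \<open>0\<close>).\<close>

definition epowr :: "ennreal \<Rightarrow> real \<Rightarrow> ennreal" where
  "epowr x a = (if x = \<infinity> then \<infinity> else ennreal (enn2real x powr a))"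

definition mean :: "'a measure \<Rightarrow> 'a set \<Rightarrow> ('a \<Rightarrow> ennreal) \<Rightarrow> ennreal" where
  "mean M Q f = (\<integral>\<^sup>+ x\<in>Q. f x \<partial>M) / emeasure M Q"

definition dyadic_doubling :: "'a measure \<Rightarrow> ('a, 'i) cube_family \<Rightarrow> ('a \<Rightarrow> ennreal) \<Rightarrow> bool" where
  "dyadic_doubling M D w \<longleftrightarrow> (\<exists>C::real. \<forall>k. \<forall>\<beta>\<in>idx D k. \<forall>\<gamma>\<in>children D k \<beta>.
     0 < (\<integral>\<^sup>+ x\<in>cube D k \<beta>. w x \<partial>M) \<and>
     (\<integral>\<^sup>+ x\<in>cube D k \<beta>. w x \<partial>M) \<le> ennreal C * (\<integral>\<^sup>+ x\<in>cube D (k + 1) \<gamma>. w x \<partial>M) \<and>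
     ennreal C * (\<integral>\<^sup>+ x\<in>cube D (k + 1) \<gamma>. w x \<partial>M) < \<infinity>)"

definition RH_dyadic :: "'a measure \<Rightarrow> ('a, 'i) cube_family \<Rightarrow> real \<Rightarrow> ('a \<Rightarrow> ennreal) \<Rightarrow> bool" where
  "RH_dyadic M D q w \<longleftrightarrow> dyadic_doubling M D w \<and>
     (SUP k. SUP \<beta>\<in>idx D k.
        epowr (mean M (cube D k \<beta>) (\<lambda>x. epowr (w x) q)) (1 / q) *
        inverse (mean M (cube D k \<beta>) w)) < \<infinity>"

text \<open>In \<open>ennreal\<close>, \<open>1 / 0 = \<infinity>\<close> and \<open>1 / \<infinity> = 0\<close>, so the second factor is infinite if \<open>w\<close>
  vanishes on a subset of positive measure of the cube.\<close>

definition A_dyadic :: "'a measure \<Rightarrow> ('a, 'i) cube_family \<Rightarrow> real \<Rightarrow> ('a \<Rightarrow> ennreal) \<Rightarrow> bool" where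
  "A_dyadic M D p w \<longleftrightarrow>
     (SUP k. SUP \<beta>\<in>idx D k.
        mean M (cube D k \<beta>) w *
        epowr (mean M (cube D k \<beta>) (\<lambda>x. epowr (1 / w x) (1 / (p - 1)))) (p - 1)) < \<infinity>"

end

theory Submission
  imports Defs
begin

text \<open>
Write \<open>\<nu> = w d\<mu>\<close> and \<open>a\<^sub>Q = \<mu>(Q) / \<nu>(Q)\<close>. With \<open>e = 1 / (p - 1)\<close>, the \<open>A\<^sub>p\<close> condition asks for a constant
\<open>s\<close> such that
  \<open>\<integral>\<^sub>Q w\<^sup>-\<^sup>e d\<mu> \<le> s (a\<^sub>Q)\<^sup>e \<mu>(Q)\<close> for all dyadic cubes \<open>Q\<close>.

The reverse Hoelder inequality says that \<open>w\<close> cannot concentrate on a small part of a cube, so a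
set carrying at least half of \<open>\<nu>(Q)\<close> has \<open>\<mu>\<close>-measure at least \<open>\<theta> \<mu>(Q)\<close> (lemma \<open>A_infinity\<close>). Fix \<open>Q\<close> and
let \<open>\<Omega>\<close> be the union of the cubes \<open>P \<subseteq> Q\<close> with \<open>a\<^sub>P > 2 a\<^sub>Q\<close>. Summing over the maximal ones gives
\<open>\<nu>(\<Omega>) \<le> \<mu>(\<Omega>) / (2 a\<^sub>Q) \<le> \<nu>(Q) / 2\<close>, whence \<open>\<mu>(\<Omega>) \<le> (1 - \<theta>) \<mu>(Q)\<close> (lemma \<open>measure_bad\<close>). A maximal \<open>P\<close>
has a parent that was not selected, and dyadic doubling of \<open>w\<close> with constant \<open>C\<close> then gives
\<open>a\<^sub>P \<le> 2 C a\<^sub>Q\<close> (lemma \<open>avg_topmost_stopping\<close>). Off \<open>\<Omega>\<close> no small cube is selected, and therefore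
\<open>w \<ge> 1 / (4 a\<^sub>Q)\<close> almost everywhere (lemma \<open>AE_large_off_bad\<close>); this is the only place where
Borel regularity enters.

If the desired bound holds with a constant \<open>s\<close> on all maximal cubes \<open>P\<close>, then splitting \<open>Q\<close> into
\<open>\<Omega>\<close> and its complement gives it on \<open>Q\<close> with the constant \<open>4\<^sup>e + (2 C)\<^sup>e (1 - \<theta>) s\<close> (lemma \<open>bootstrap\<close>).
For small \<open>e\<close> the factor \<open>(2 C)\<^sup>e (1 - \<theta>)\<close> is less than 1, and iterating leads to a bound that does not
depend on the initial \<open>s\<close>. To have some finite \<open>s\<close> to start from, \<open>w\<^sup>-\<^sup>e\<close> is truncated at height
\<open>n\<close> and only the cubes with \<open>a\<^sub>Q\<close> above a fixed level are considered, which is harmless because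
\<open>a\<^sub>P > a\<^sub>Q\<close> for the selected cubes. Finally \<open>n\<close> tends to infinity.
\<close>

section \<open>Powers of extended nonnegative reals\<close>

lemma epowr_ennreal: "r \<ge> 0 \<Longrightarrow> epowr (ennreal r) a = ennreal (r powr a)"
  by (simp add: epowr_def)

lemma epowr_mono:
  assumes "x \<le> y" "a > 0"
  shows "epowr x a \<le> epowr y a"
proof (cases y)
  case (real r)
  with assms(1) obtain s where "x = ennreal s" "0 \<le> s" "s \<le> r"
    by (cases x) (auto simp: ennreal_le_iff top_unique)
  with real assms(2) show ?thesis
    by (simp add: epowr_ennreal powr_mono2)
qed (simp add: epowr_def)

lemma measurable_epowr [measurable]:
  assumes [measurable]: "f \<in> borel_measurable M"
  shows "(\<lambda>x. epowr (f x) a) \<in> borel_measurable M"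
  unfolding epowr_def infinity_ennreal_def by measurable

lemma le_powr_of_epowr_le:
  assumes "epowr x (1 / a) \<le> ennreal b" "a > 0" "b \<ge> 0"
  shows "x \<le> ennreal (b powr a)"
proof (cases x)
  case (real r)
  with assms(1,3) have "r powr (1 / a) \<le> b"
    by (simp add: epowr_ennreal)
  then have "(r powr (1 / a)) powr a \<le> b powr a"
    using assms(2) by (intro powr_mono2) auto
  then have "r \<le> b powr a"
    using real assms(2) by (simp add: powr_powr)
  with real show ?thesis by simp
next
  case top
  with assms(1) show ?thesis by (simp add: epowr_def top_unique)
qed

lemma one_divide_le_ennreal:
  assumes "ennreal (1 / a) \<le> x" "a > 0"
  shows "1 / x \<le> ennreal a"
proof (cases x)
  case (real r)
  with assms have r: "1 / a \<le> r" by simp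
  moreover have "0 < 1 / a" using assms(2) by simp
  ultimately have "r > 0" by linarith
  with r assms(2) have "1 / r \<le> a" by (simp add: field_simps)
  have "1 / x = ennreal (1 / r)"
    using real \<open>r > 0\<close> divide_ennreal[of 1 r] by simp
  also have "\<dots> \<le> ennreal a"
    using \<open>1 / r \<le> a\<close> by (rule ennreal_leI)
  finally show ?thesis .
qed simp

text \<open>Where \<open>x > t\<close>, the quotient \<open>x / x\<^sup>q\<close> is smaller than \<open>t / t\<^sup>q\<close>. Integrated over a set, this elementary
  inequality takes the place of Hoelder's inequality below.\<close>
lemma le_truncation_plus_epowr:
  assumes t: "t > 0" and q: "q > 1"
  shows "x \<le> ennreal t + ennreal (t powr (1 - q)) * epowr x q"
proof (cases x)
  case (real r)
  have "r \<le> t + t powr (1 - q) * r powr q"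
  proof (cases "r \<le> t")
    case True
    then show ?thesis using t by (simp add: add_increasing2)
  next
    case False
    then have "r = r powr (1 - q) * r powr q"
      using t by (simp flip: powr_add)
    also have "\<dots> \<le> t powr (1 - q) * r powr q"
      using False t q by (intro mult_right_mono powr_mono2') auto
    finally show ?thesis using t by simp
  qed
  with real t show ?thesis
    by (simp add: epowr_ennreal flip: ennreal_mult ennreal_plus)
next
  case top
  with t show ?thesis by (simp add: epowr_def ennreal_mult_top)
qed

section \<open>Dyadic grids and stopping cubes\<close>

text \<open>All that the stopping argument uses of a dyadic system: the tree structure, and the possibility
  of covering a set of \<open>B\<close>, which stands for the Borel algebra, by subcubes of a given cube with
  little excess. Cubes are reached through indices, so that the same set occurring in several
  generations counts several times.\<close>
locale dyadic_grid =
  fixes M :: "'a measure" and B :: "'a measure"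
    and J :: "'j set" and gen :: "'j \<Rightarrow> int" and Q :: "'j \<Rightarrow> 'a set"
  assumes B_sets: "sets B \<subseteq> sets M"
    and countable_J: "countable J"
    and Q_B: "i \<in> J \<Longrightarrow> Q i \<in> sets B"
    and nested: "i \<in> J \<Longrightarrow> j \<in> J \<Longrightarrow> gen i \<le> gen j \<Longrightarrow> Q i \<inter> Q j \<noteq> {} \<Longrightarrow> Q j \<subseteq> Q i"
    and same_gen: "i \<in> J \<Longrightarrow> j \<in> J \<Longrightarrow> gen i = gen j \<Longrightarrow> Q i \<inter> Q j \<noteq> {} \<Longrightarrow> i = j"
    and parent: "j \<in> J \<Longrightarrow> \<exists>i\<in>J. gen j = gen i + 1 \<and> Q j \<subseteq> Q i"
    and pos: "i \<in> J \<Longrightarrow> emeasure M (Q i) > 0"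
    and fin: "i \<in> J \<Longrightarrow> emeasure M (Q i) < \<infinity>"
    and outer: "i \<in> J \<Longrightarrow> E \<in> sets B \<Longrightarrow> E \<subseteq> Q i \<Longrightarrow> d > 0 \<Longrightarrow>
      \<exists>G. G \<subseteq> {j \<in> J. gen i \<le> gen j \<and> Q j \<subseteq> Q i} \<and> E \<subseteq> \<Union> (Q ` G) \<and>
          emeasure M (\<Union> (Q ` G)) \<le> emeasure M E + ennreal d"
begin

lemma Q_M [measurable]: "i \<in> J \<Longrightarrow> Q i \<in> sets M"
  using Q_B B_sets by blast

lemma nonempty: "i \<in> J \<Longrightarrow> Q i \<noteq> {}"
  using pos by fastforce

lemma UN_B: "F \<subseteq> J \<Longrightarrow> \<Union> (Q ` F) \<in> sets B"
  using countable_J by (intro sets.countable_UN'') (auto intro: countable_subset Q_B)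

lemma UN_M: "F \<subseteq> J \<Longrightarrow> \<Union> (Q ` F) \<in> sets M"
  using UN_B B_sets by blast

text \<open>A set that occurs in \<open>F\<close> in several generations is kept in the coarsest one only, which is what
  makes the family \<open>Q\<close> disjoint on \<open>topmost F\<close>.\<close>
definition topmost :: "'j set \<Rightarrow> 'j set" where
  "topmost F = {j \<in> F. \<forall>i\<in>F. gen i < gen j \<longrightarrow> \<not> Q j \<subseteq> Q i}"

lemma disjoint_topmost:
  assumes "F \<subseteq> J"
  shows "disjoint_family_on Q (topmost F)"
proof -
  have *: "gen i \<ge> gen j" if "i \<in> topmost F" "j \<in> topmost F" "Q i \<inter> Q j \<noteq> {}" for i j
  proof (rule ccontr)
    assume "\<not> gen i \<ge> gen j"
    moreover have "i \<in> F" "j \<in> F" using that by (auto simp: topmost_def)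
    ultimately show False
      using that nested[of i j] assms by (auto simp: topmost_def)
  qed
  show ?thesis
    unfolding disjoint_family_on_def
  proof (intro ballI impI, rule ccontr)
    fix i j assume ij: "i \<in> topmost F" "j \<in> topmost F" "i \<noteq> j" "Q i \<inter> Q j \<noteq> {}"
    with *[of i j] *[of j i] have "gen i = gen j" by (simp add: Int_commute)
    with ij assms same_gen[of i j] show False by (auto simp: topmost_def)
  qed
qed

text \<open>Without a bound on the generations there could be infinite ascending chains of cubes.\<close>
lemma UN_topmost:
  assumes lower: "\<And>j. j \<in> F \<Longrightarrow> k \<le> gen j"
  shows "\<Union> (Q ` topmost F) = \<Union> (Q ` F)"
proof (intro antisym subsetI)
  fix x assume "x \<in> \<Union> (Q ` F)"
  then have "\<exists>n j. j \<in> F \<and> x \<in> Q j \<and> nat (gen j - k) = n" by auto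
  then obtain n j where j: "j \<in> F" "x \<in> Q j" "nat (gen j - k) = n"
    and least: "\<And>i. i \<in> F \<Longrightarrow> x \<in> Q i \<Longrightarrow> nat (gen i - k) \<ge> n"
    using exists_least_iff[of "\<lambda>n. \<exists>j. j \<in> F \<and> x \<in> Q j \<and> nat (gen j - k) = n"]
    by (metis not_le)
  have "\<not> Q j \<subseteq> Q i" if "i \<in> F" "gen i < gen j" for i
    using least[of i] that j lower[of i] lower[of j] by auto
  with j show "x \<in> \<Union> (Q ` topmost F)" by (auto simp: topmost_def)
qed (auto simp: topmost_def)

text \<open>How inequalities between two measures pass from cubes to unions of cubes, overlapping or not.\<close>
lemma emeasure_UN_le:
  assumes F: "F \<subseteq> J" and lower: "\<And>j. j \<in> F \<Longrightarrow> k \<le> gen j"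
    and sets: "sets N1 = sets M" "sets N2 = sets M"
    and le: "\<And>j. j \<in> topmost F \<Longrightarrow> emeasure N1 (Q j) \<le> c * emeasure N2 (Q j)"
  shows "emeasure N1 (\<Union> (Q ` F)) \<le> c * emeasure N2 (\<Union> (Q ` F))"
proof -
  have T: "topmost F \<subseteq> J" using F by (auto simp: topmost_def)
  have U: "\<Union> (Q ` F) = \<Union> (Q ` topmost F)"
    using UN_topmost[of F k] lower by simp
  have sum: "emeasure N (\<Union> (Q ` F)) = (\<integral>\<^sup>+ j. emeasure N (Q j) \<partial>count_space (topmost F))"
    if "sets N = sets M" for N
    unfolding U
    using T countable_J that Q_M disjoint_topmost[OF F]
    by (intro emeasure_UN_countable) (auto intro: countable_subset)
  have "emeasure N1 (\<Union> (Q ` F)) \<le> (\<integral>\<^sup>+ j. c * emeasure N2 (Q j) \<partial>count_space (topmost F))"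
    unfolding sum[OF sets(1)] using le by (intro nn_integral_mono) simp
  also have "\<dots> = c * emeasure N2 (\<Union> (Q ` F))"
    unfolding sum[OF sets(2)] by (rule nn_integral_cmult) simp
  finally show ?thesis .
qed

end

section \<open>Weights satisfying a reverse Hoelder inequality\<close>

text \<open>The Borel function \<open>g\<close> is needed because the covering property of the grid is available for
  Borel sets only, and sublevel sets of \<open>w\<close> need not be Borel.\<close>
locale rh_weight = dyadic_grid M B J gen Q
  for M B :: "'a measure" and J :: "'j set" and gen :: "'j \<Rightarrow> int" and Q :: "'j \<Rightarrow> 'a set" +
  fixes w g :: "'a \<Rightarrow> ennreal" and C q K :: real
  assumes w_meas [measurable]: "w \<in> borel_measurable M"
    and g_meas: "g \<in> borel_measurable B" and w_eq_g: "AE x in M. w x = g x"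
    and C: "C \<ge> 1" and q: "q > 1" and K: "K \<ge> 1"
    and w_pos: "i \<in> J \<Longrightarrow> emeasure (density M w) (Q i) > 0"
    and w_fin: "i \<in> J \<Longrightarrow> emeasure (density M w) (Q i) < \<infinity>"
    and w_doubling: "i \<in> J \<Longrightarrow> j \<in> J \<Longrightarrow> gen j = gen i + 1 \<Longrightarrow> Q j \<subseteq> Q i \<Longrightarrow>
      measure (density M w) (Q i) \<le> C * measure (density M w) (Q j)"
    and reverse_Hoelder: "i \<in> J \<Longrightarrow>
      emeasure (density M (\<lambda>x. epowr (w x) q)) (Q i) \<le>
      ennreal (K * (measure (density M w) (Q i) / measure M (Q i)) powr q * measure M (Q i))"
begin

abbreviation N :: "'a measure" where "N \<equiv> density M w"

text \<open>The mean of \<open>1 / w\<close> over the cube with respect to \<open>N\<close>.\<close>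
definition avg :: "'j \<Rightarrow> real" where
  "avg i = measure M (Q i) / measure N (Q i)"

lemma M_pos: "i \<in> J \<Longrightarrow> measure M (Q i) > 0"
  using pos[of i] fin[of i] by (simp add: measure_def enn2real_positive_iff)

lemma N_pos: "i \<in> J \<Longrightarrow> measure N (Q i) > 0"
  using w_pos[of i] w_fin[of i] by (simp add: measure_def enn2real_positive_iff)

lemma avg_pos: "i \<in> J \<Longrightarrow> avg i > 0"
  using M_pos N_pos by (simp add: avg_def)

lemma M_eq: "i \<in> J \<Longrightarrow> measure M (Q i) = avg i * measure N (Q i)"
  using N_pos[of i] by (simp add: avg_def)

lemma fmeasurable_M: "i \<in> J \<Longrightarrow> A \<in> sets M \<Longrightarrow> A \<subseteq> Q i \<Longrightarrow> A \<in> fmeasurable M"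
  using fin[of i] Q_M[of i] emeasure_mono[of A "Q i" M] by (intro fmeasurableI) auto

lemma fmeasurable_N: "i \<in> J \<Longrightarrow> A \<in> sets M \<Longrightarrow> A \<subseteq> Q i \<Longrightarrow> A \<in> fmeasurable N"
  using w_fin[of i] Q_M[of i] emeasure_mono[of A "Q i" N] by (intro fmeasurableI) auto

lemma emeasure_M: "i \<in> J \<Longrightarrow> A \<in> sets M \<Longrightarrow> A \<subseteq> Q i \<Longrightarrow> emeasure M A = ennreal (measure M A)"
  by (rule emeasure_eq_measure2[OF fmeasurable_M])

lemma emeasure_N: "i \<in> J \<Longrightarrow> A \<in> sets M \<Longrightarrow> A \<subseteq> Q i \<Longrightarrow> emeasure N A = ennreal (measure N A)"
  by (rule emeasure_eq_measure2[OF fmeasurable_N])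

lemma measure_M_mono:
  "i \<in> J \<Longrightarrow> A \<in> sets M \<Longrightarrow> V \<in> sets M \<Longrightarrow> A \<subseteq> V \<Longrightarrow> V \<subseteq> Q i \<Longrightarrow> measure M A \<le> measure M V"
  by (rule measure_mono_fmeasurable[OF _ _ fmeasurable_M])

text \<open>A quantitative absolute continuity of \<open>N\<close> with respect to \<open>M\<close> inside a cube: for large \<open>t\<close> the
  second term is small, and then the first one is small if \<open>V\<close> is.\<close>
lemma N_le_truncation:
  assumes i: "i \<in> J" and V: "V \<in> sets M" "V \<subseteq> Q i" and t: "t > 0"
  shows "measure N V \<le>
    t * measure M V + t powr (1 - q) * (K * avg i powr (- q) * measure M (Q i))"
proof -
  let ?H = "density M (\<lambda>x. epowr (w x) q)"
  have "emeasure N V = (\<integral>\<^sup>+ x. w x * indicator V x \<partial>M)"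
    using V by (simp add: emeasure_density)
  also have "\<dots> \<le> (\<integral>\<^sup>+ x. ennreal t * indicator V x +
      ennreal (t powr (1 - q)) * (epowr (w x) q * indicator V x) \<partial>M)"
    using le_truncation_plus_epowr[OF t q] by (intro nn_integral_mono) (auto simp: indicator_def)
  also have "\<dots> = ennreal t * emeasure M V + ennreal (t powr (1 - q)) * emeasure ?H V"
    using V by (simp add: nn_integral_add nn_integral_cmult emeasure_density nn_integral_cmult_indicator)
  also have "\<dots> \<le> ennreal t * emeasure M V + ennreal (t powr (1 - q)) *
      ennreal (K * (measure N (Q i) / measure M (Q i)) powr q * measure M (Q i))"
    using V i by (intro add_left_mono mult_left_mono order_trans[OF emeasure_mono reverse_Hoelder]) auto
  also have "(measure N (Q i) / measure M (Q i)) powr q = avg i powr (- q)"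
    using M_pos[OF i] N_pos[OF i] by (simp add: avg_def powr_divide powr_minus_divide)
  finally show ?thesis
    using t K emeasure_M[OF i V] emeasure_N[OF i V] by (simp flip: ennreal_mult ennreal_plus)
qed

definition \<theta> :: real where
  "\<theta> = 1 / (4 * (4 * K) powr (1 / (q - 1)))"

lemma \<theta>: "0 < \<theta>" "\<theta> < 1"
proof -
  have "(4 * K) powr (1 / (q - 1)) \<ge> 1"
    using K q by (intro ge_one_powr_ge_zero) auto
  then have "4 * (4 * K) powr (1 / (q - 1)) > 1" by linarith
  then show "0 < \<theta>" "\<theta> < 1"
    unfolding \<theta>_def by (simp_all only: divide_less_eq_1 zero_less_divide_1_iff) auto
qed

text \<open>In \<open>N_le_truncation\<close> take \<open>t = s / a\<close> with \<open>a = avg i\<close>. The last term becomes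
  \<open>s\<^sup>1\<^sup>-\<^sup>q K N(Q)\<close>, which is \<open>N(Q) / 4\<close> for \<open>s = (4 K)\<close> to the power \<open>1 / (q - 1)\<close> and can be absorbed by
  \<open>N(E) \<ge> N(Q) / 2\<close>.\<close>
lemma A_infinity:
  assumes i: "i \<in> J" and E: "E \<in> sets M" "E \<subseteq> Q i"
    and large: "measure N (Q i) \<le> 2 * measure N E"
  shows "\<theta> * measure M (Q i) \<le> measure M E"
proof -
  define s where "s = (4 * K) powr (1 / (q - 1))"
  have s: "s > 0" using K by (simp add: s_def)
  have a: "avg i > 0" using avg_pos[OF i] .
  have "(1 / (q - 1)) * (1 - q) = - 1"
    using q by (simp add: field_simps)
  then have "s powr (1 - q) = (4 * K) powr (- 1)"
    by (simp only: s_def powr_powr)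
  then have sK: "s powr (1 - q) * K = 1 / 4"
    using K by (simp add: powr_minus_divide)
  have "(s / avg i) powr (1 - q) * (K * avg i powr (- q) * measure M (Q i))
      = (s powr (1 - q) * K) * (avg i powr (- q) / avg i powr (1 - q)) * measure M (Q i)"
    using a s by (simp add: powr_divide)
  also have "avg i powr (- q) / avg i powr (1 - q) = 1 / avg i"
    using powr_diff[of "avg i" "- q" "1 - q"] a by (simp add: powr_minus_divide)
  also have "s powr (1 - q) * K * (1 / avg i) * measure M (Q i) = 1 / 4 * (1 / avg i) * measure M (Q i)"
    by (simp only: sK)
  also have "\<dots> = measure N (Q i) / 4"
    using a i by (simp add: M_eq)
  finally have "measure N E \<le> s / avg i * measure M E + measure N (Q i) / 4"
    using N_le_truncation[OF i E, of "s / avg i"] s a by simp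
  with large have "measure N (Q i) \<le> 4 * s / avg i * measure M E" by simp
  then have "avg i * measure N (Q i) \<le> 4 * s * measure M E"
    using a by (simp add: field_simps)
  then show ?thesis
    using s i unfolding \<theta>_def s_def[symmetric] by (simp add: M_eq field_simps)
qed

definition stopping :: "'j \<Rightarrow> 'j set" where
  "stopping i = {j \<in> J. gen i \<le> gen j \<and> Q j \<subseteq> Q i \<and> avg j > 2 * avg i}"

definition bad :: "'j \<Rightarrow> 'a set" where
  "bad i = \<Union> (Q ` stopping i)"

lemma bad: "bad i \<in> sets B" "bad i \<in> sets M" "bad i \<subseteq> Q i"
  using UN_B[of "stopping i"] UN_M[of "stopping i"] by (auto simp: bad_def stopping_def)

text \<open>A maximal stopping cube is not \<open>Q i\<close> itself, so its parent lies inside \<open>Q i\<close> and is not a stopping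
  cube. Doubling compares \<open>N\<close> on the two, and monotonicity suffices for \<open>M\<close>.\<close>
lemma avg_topmost_stopping:
  assumes i: "i \<in> J" and j: "j \<in> topmost (stopping i)"
  shows "avg j \<le> 2 * C * avg i"
proof -
  from j have jJ: "j \<in> J" and jl: "gen i \<le> gen j" "Q j \<subseteq> Q i" "avg j > 2 * avg i"
    by (auto simp: topmost_def stopping_def)
  have "gen i \<noteq> gen j"
  proof
    assume "gen i = gen j"
    with same_gen[OF i jJ] jl nonempty[OF jJ] have "i = j" by auto
    with jl avg_pos[OF i] show False by simp
  qed
  obtain p where p: "p \<in> J" "gen j = gen p + 1" "Q j \<subseteq> Q p"
    using parent[OF jJ] by blast
  have "Q p \<subseteq> Q i"
    using nested[OF i p(1)] p jl \<open>gen i \<noteq> gen j\<close> nonempty[OF jJ] by auto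
  with p j jl \<open>gen i \<noteq> gen j\<close> have ap: "avg p \<le> 2 * avg i"
    by (auto simp: topmost_def stopping_def not_less)
  have "avg j * measure N (Q j) = measure M (Q j)" using M_eq[OF jJ] by simp
  also have "\<dots> \<le> measure M (Q p)"
    using p Q_M[OF jJ] Q_M[OF p(1)] by (intro measure_M_mono[OF p(1)]) auto
  also have "\<dots> = avg p * measure N (Q p)" using M_eq[OF p(1)] .
  also have "\<dots> \<le> 2 * avg i * (C * measure N (Q j))"
    using ap w_doubling[OF p(1) jJ] p avg_pos[OF i] by (intro mult_mono) auto
  finally have "avg j * measure N (Q j) \<le> (2 * C * avg i) * measure N (Q j)"
    by (simp add: mult_ac)
  then show ?thesis using N_pos[OF jJ] by simp
qed

text \<open>Stopping cubes satisfy \<open>2 a N(P) \<le> M(P)\<close> with \<open>a = avg i\<close>. Hence \<open>2 a N(bad i) \<le> M(Q i) = a N(Q i)\<close>: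
  at least half of \<open>N(Q i)\<close> lies outside the bad set, and \<open>A_infinity\<close> applies to the
  complement.\<close>
lemma measure_bad:
  assumes i: "i \<in> J"
  shows "measure M (bad i) \<le> (1 - \<theta>) * measure M (Q i)"
proof -
  have a: "avg i > 0" using avg_pos[OF i] .
  have "emeasure N (bad i) \<le> ennreal (1 / (2 * avg i)) * emeasure M (bad i)"
    unfolding bad_def
  proof (rule emeasure_UN_le[where k = "gen i"])
    fix j assume "j \<in> topmost (stopping i)"
    then have j: "j \<in> J" "avg j > 2 * avg i" by (auto simp: topmost_def stopping_def)
    have "measure N (Q j) * (2 * avg i) \<le> measure M (Q j)"
      using M_eq[OF j(1)] N_pos[OF j(1)] j(2) by simp
    then have "measure N (Q j) \<le> 1 / (2 * avg i) * measure M (Q j)"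
      using a by (simp add: field_simps)
    then show "emeasure N (Q j) \<le> ennreal (1 / (2 * avg i)) * emeasure M (Q j)"
      using emeasure_N[OF j(1)] emeasure_M[OF j(1)] Q_M[OF j(1)] a by (simp flip: ennreal_mult)
  qed (auto simp: stopping_def)
  then have "measure N (bad i) \<le> 1 / (2 * avg i) * measure M (bad i)"
    using emeasure_N[OF i bad(2,3)] emeasure_M[OF i bad(2,3)] a by (simp flip: ennreal_mult)
  also have "\<dots> \<le> 1 / (2 * avg i) * measure M (Q i)"
    using a bad Q_M[OF i] by (intro mult_left_mono measure_M_mono[OF i]) auto
  also have "\<dots> = measure N (Q i) / 2"
    using a i by (simp add: M_eq)
  finally have "measure N (Q i) \<le> 2 * measure N (Q i - bad i)"
    using measurable_measure_Diff[OF fmeasurable_N[OF i Q_M[OF i]], of "bad i"] bad i by simp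
  then have "\<theta> * measure M (Q i) \<le> measure M (Q i - bad i)"
    using A_infinity[OF i, of "Q i - bad i"] bad i by auto
  also have "\<dots> = measure M (Q i) - measure M (bad i)"
    using measurable_measure_Diff[OF fmeasurable_M[OF i Q_M[OF i]], of "bad i"] bad i by simp
  finally show ?thesis by (simp add: algebra_simps)
qed

text \<open>A substitute for the Lebesgue differentiation theorem. Cover the Borel set \<open>E\<close> of small values by
  cubes with small excess and discard those that miss \<open>E\<close>. As \<open>E\<close> avoids the bad set, no
  remaining cube is a stopping cube, so their union \<open>V\<close> satisfies \<open>M(V) \<le> 2 a N(V)\<close> with
  \<open>a = avg i\<close>. But \<open>N(E) \<le> M(E) / (4 a)\<close>, and \<open>N(V - E)\<close> is negligible by absolute continuity, so that
  in the limit \<open>M(E) \<le> M(E) / 2\<close>.\<close>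
lemma small_off_bad_null:
  assumes i: "i \<in> J"
  defines "E \<equiv> {x \<in> Q i. g x < ennreal (1 / (4 * avg i))} - bad i"
  shows "E \<in> sets B" "measure M E = 0"
proof -
  have a: "avg i > 0" using avg_pos[OF i] .
  have "Q i \<inter> {x \<in> space B. g x < ennreal (1 / (4 * avg i))} - bad i \<in> sets B"
    using g_meas Q_B[OF i] bad(1) by measurable
  also have "Q i \<inter> {x \<in> space B. g x < ennreal (1 / (4 * avg i))} - bad i = E"
    using sets.sets_into_space[OF Q_B[OF i]] by (auto simp: E_def)
  finally show EB: "E \<in> sets B" .
  then have EM: "E \<in> sets M" and EQ: "E \<subseteq> Q i" using B_sets by (auto simp: E_def)
  define I where "I = K * avg i powr (- q) * measure M (Q i)"
  have "emeasure N E = (\<integral>\<^sup>+ x. w x * indicator E x \<partial>M)"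
    using EM by (simp add: emeasure_density)
  also have "\<dots> \<le> (\<integral>\<^sup>+ x. ennreal (1 / (4 * avg i)) * indicator E x \<partial>M)"
    using w_eq_g by (intro nn_integral_mono_AE) (auto simp: indicator_def E_def elim!: eventually_mono)
  also have "\<dots> = ennreal (1 / (4 * avg i)) * emeasure M E"
    using EM by (simp add: nn_integral_cmult_indicator)
  finally have NE: "measure N E \<le> 1 / (4 * avg i) * measure M E"
    using emeasure_N[OF i EM EQ] emeasure_M[OF i EM EQ] a by (simp flip: ennreal_mult)
  \<comment> \<open>The excess of the cover is coupled to the truncation height: with excess \<open>1 / t\<^sup>2\<close>, both terms of
    \<open>N_le_truncation\<close> vanish as \<open>t \<rightarrow> \<infinity>\<close>.\<close>
  have bound: "measure M E \<le> 4 * avg i * (1 / t + t powr (1 - q) * I)" if t: "t > 0" for t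
  proof -
    from t obtain G where G: "G \<subseteq> {j \<in> J. gen i \<le> gen j \<and> Q j \<subseteq> Q i}" "E \<subseteq> \<Union> (Q ` G)"
        "emeasure M (\<Union> (Q ` G)) \<le> emeasure M E + ennreal (1 / t\<^sup>2)"
      using outer[OF i EB EQ, of "1 / t\<^sup>2"] by auto
    define G' where "G' = {j \<in> G. Q j \<inter> E \<noteq> {}}"
    define V where "V = \<Union> (Q ` G')"
    have VM: "V \<in> sets M" using G by (auto simp: V_def G'_def intro!: UN_M)
    have VQ: "V \<subseteq> Q i" using G by (auto simp: V_def G'_def)
    have EV: "E \<subseteq> V" using G(2) unfolding V_def G'_def by blast
    have "emeasure M V \<le> emeasure M (\<Union> (Q ` G))"
      using G by (intro emeasure_mono UN_M) (auto simp: V_def G'_def)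
    also note G(3)
    finally have MV: "measure M V \<le> measure M E + 1 / t\<^sup>2"
      using emeasure_M[OF i EM EQ] emeasure_M[OF i VM VQ] by (simp flip: ennreal_plus)
    have "emeasure M V \<le> ennreal (2 * avg i) * emeasure N V"
      unfolding V_def
    proof (rule emeasure_UN_le[where k = "gen i"])
      fix j assume "j \<in> topmost G'"
      then have jG: "j \<in> G" and "Q j \<inter> E \<noteq> {}" by (auto simp: topmost_def G'_def)
      with G have j: "j \<in> J" "j \<notin> stopping i" by (auto simp: E_def bad_def)
      with jG G(1) have "avg j \<le> 2 * avg i" by (auto simp: stopping_def not_less)
      then have "measure M (Q j) \<le> 2 * avg i * measure N (Q j)"
        using M_eq[OF j(1)] N_pos[OF j(1)] by simp
      then show "emeasure M (Q j) \<le> ennreal (2 * avg i) * emeasure N (Q j)"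
        using emeasure_N[OF j(1)] emeasure_M[OF j(1)] Q_M[OF j(1)] a by (simp flip: ennreal_mult)
    qed (use G in \<open>auto simp: G'_def\<close>)
    then have "measure M V \<le> 2 * avg i * measure N V"
      using emeasure_N[OF i VM VQ] emeasure_M[OF i VM VQ] a by (simp flip: ennreal_mult)
    also have "measure N V = measure N E + measure N (V - E)"
      using measurable_measure_Diff[OF fmeasurable_N[OF i VM VQ], of E] EM EV by simp
    also have "measure N (V - E) \<le> t * measure M (V - E) + t powr (1 - q) * I"
      unfolding I_def using VM EM VQ t by (intro N_le_truncation[OF i]) auto
    also have "measure M (V - E) = measure M V - measure M E"
      using measurable_measure_Diff[OF fmeasurable_M[OF i VM VQ], of E] EM EV by simp
    also have "t * (measure M V - measure M E) \<le> t * (1 / t\<^sup>2)"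
      using MV t by (intro mult_left_mono) auto
    also have "t * (1 / t\<^sup>2) = 1 / t" using t by (simp add: power2_eq_square)
    finally have "measure M V \<le> 2 * avg i * (measure N E + (1 / t + t powr (1 - q) * I))"
      using a by simp
    also have "\<dots> \<le> 2 * avg i * (1 / (4 * avg i) * measure M E + (1 / t + t powr (1 - q) * I))"
      using NE a by (intro mult_left_mono add_right_mono) auto
    finally have "measure M V \<le> measure M E / 2 + 2 * avg i * (1 / t + t powr (1 - q) * I)"
      using a by (simp add: distrib_left)
    moreover have "measure M E \<le> measure M V"
      by (rule measure_M_mono[OF i EM VM EV VQ])
    ultimately show ?thesis by simp
  qed
  have "((\<lambda>t. 4 * avg i * (1 / t + t powr (1 - q) * I)) \<longlongrightarrow> 4 * avg i * (0 + 0 * I)) at_top"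
    using q by (intro tendsto_intros tendsto_neg_powr filterlim_ident
      tendsto_divide_0[OF tendsto_const filterlim_at_top_imp_at_infinity]) auto
  then have "measure M E \<le> 4 * avg i * (0 + 0 * I)"
    by (rule tendsto_lowerbound)
      (auto intro!: bound eventually_mono[OF eventually_gt_at_top[of 0]])
  then show "measure M E = 0" using measure_nonneg[of M E] by simp
qed

lemma AE_large_off_bad:
  assumes i: "i \<in> J"
  shows "AE x in M. x \<in> Q i - bad i \<longrightarrow> ennreal (1 / (4 * avg i)) \<le> w x"
proof -
  let ?E = "{x \<in> Q i. g x < ennreal (1 / (4 * avg i))} - bad i"
  have E: "?E \<in> sets M" using small_off_bad_null[OF i] B_sets by auto
  then have "emeasure M ?E = ennreal (measure M ?E)" by (intro emeasure_M[OF i]) auto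
  then have "?E \<in> null_sets M" using E small_off_bad_null(2)[OF i] by auto
  then have "AE x in M. x \<notin> ?E" by (rule AE_not_in)
  with w_eq_g show ?thesis by eventually_elim (auto simp: not_less)
qed

definition trunc :: "real \<Rightarrow> real \<Rightarrow> 'a measure" where
  "trunc e n = density M (\<lambda>x. min (epowr (1 / w x) e) (ennreal n))"

text \<open>The induction hypothesis of the iteration below is applied at the maximal stopping cubes \<open>j\<close>
  of \<open>i\<close>. These have \<open>avg j > avg i\<close>, so the restriction to cubes with \<open>\<alpha> \<le> avg j\<close> is inherited.\<close>
lemma bootstrap:
  assumes e: "e > 0" "(2 * C) powr e * (1 - \<theta>) \<le> r" and s: "s \<ge> 0"
    and hyp: "\<And>j. j \<in> J \<Longrightarrow> \<alpha> \<le> avg j \<Longrightarrow>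
      emeasure (trunc e n) (Q j) \<le> ennreal (s * avg j powr e * measure M (Q j))"
    and i: "i \<in> J" "\<alpha> \<le> avg i"
  shows "emeasure (trunc e n) (Q i) \<le>
    ennreal ((4 powr e + r * s) * avg i powr e * measure M (Q i))"
proof -
  have a: "avg i > 0" using avg_pos[OF i(1)] .
  have tm [measurable_cong]: "sets (trunc e n) = sets M" by (simp add: trunc_def)
  have "emeasure (trunc e n) (Q i - bad i) =
      (\<integral>\<^sup>+ x. min (epowr (1 / w x) e) (ennreal n) * indicator (Q i - bad i) x \<partial>M)"
    using Q_M[OF i(1)] bad(2)[of i] unfolding trunc_def by (intro emeasure_density) auto
  also have "\<dots> \<le> (\<integral>\<^sup>+ x. ennreal ((4 * avg i) powr e) * indicator (Q i - bad i) x \<partial>M)"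
    using AE_large_off_bad[OF i(1)]
  proof (intro nn_integral_mono_AE, eventually_elim)
    fix x assume x: "x \<in> Q i - bad i \<longrightarrow> ennreal (1 / (4 * avg i)) \<le> w x"
    have "epowr (1 / w x) e \<le> ennreal ((4 * avg i) powr e)" if "ennreal (1 / (4 * avg i)) \<le> w x"
    proof -
      have "epowr (1 / w x) e \<le> epowr (ennreal (4 * avg i)) e"
        using a e that by (intro epowr_mono one_divide_le_ennreal) auto
      then show ?thesis using a by (simp add: epowr_ennreal)
    qed
    with x show "min (epowr (1 / w x) e) (ennreal n) * indicator (Q i - bad i) x
        \<le> ennreal ((4 * avg i) powr e) * indicator (Q i - bad i) x"
      by (auto simp: indicator_def min_le_iff_disj)
  qed
  also have "\<dots> = ennreal ((4 * avg i) powr e) * emeasure M (Q i - bad i)"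
    using Q_M[OF i(1)] bad(2)[of i] by (simp add: nn_integral_cmult_indicator)
  also have "\<dots> \<le> ennreal ((4 * avg i) powr e) * emeasure M (Q i)"
    using Q_M[OF i(1)] by (intro mult_left_mono emeasure_mono) auto
  finally have good: "emeasure (trunc e n) (Q i - bad i) \<le>
      ennreal (4 powr e * avg i powr e * measure M (Q i))"
    using emeasure_M[OF i(1) Q_M[OF i(1)]] a by (simp add: powr_mult flip: ennreal_mult)
  have "emeasure (trunc e n) (bad i) \<le> ennreal (s * (2 * C * avg i) powr e) * emeasure M (bad i)"
    unfolding bad_def
  proof (rule emeasure_UN_le[where k = "gen i"])
    fix j assume j: "j \<in> topmost (stopping i)"
    then have jJ: "j \<in> J" "avg j > 2 * avg i" by (auto simp: topmost_def stopping_def)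
    have "emeasure (trunc e n) (Q j) \<le> ennreal (s * avg j powr e * measure M (Q j))"
      using jJ i a by (intro hyp) auto
    also have "\<dots> \<le> ennreal (s * (2 * C * avg i) powr e * measure M (Q j))"
      using avg_topmost_stopping[OF i(1) j] s e avg_pos[OF jJ(1)]
      by (intro ennreal_leI mult_right_mono mult_left_mono powr_mono2) auto
    finally show "emeasure (trunc e n) (Q j) \<le> ennreal (s * (2 * C * avg i) powr e) * emeasure M (Q j)"
      using emeasure_M[OF jJ(1) Q_M[OF jJ(1)]] s by (simp flip: ennreal_mult)
  qed (auto simp: stopping_def tm)
  also have "\<dots> = ennreal (s * (2 * C * avg i) powr e * measure M (bad i))"
    using emeasure_M[OF i(1) bad(2,3)] s by (simp flip: ennreal_mult)
  also have "\<dots> \<le> ennreal (s * (2 * C * avg i) powr e * ((1 - \<theta>) * measure M (Q i)))"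
    using measure_bad[OF i(1)] s by (intro ennreal_leI mult_left_mono) auto
  also have "s * (2 * C * avg i) powr e * ((1 - \<theta>) * measure M (Q i)) =
      ((2 * C) powr e * (1 - \<theta>)) * (s * avg i powr e * measure M (Q i))"
    using C a by (simp add: powr_mult mult_ac)
  also have "ennreal \<dots> \<le> ennreal (r * (s * avg i powr e * measure M (Q i)))"
    using e s by (intro ennreal_leI mult_right_mono) auto
  finally have bd: "emeasure (trunc e n) (bad i) \<le> ennreal (r * (s * avg i powr e * measure M (Q i)))" .
  have r: "r \<ge> 0" using order_trans[OF _ e(2)] \<theta> by simp
  have "emeasure (trunc e n) (Q i) = emeasure (trunc e n) (bad i) + emeasure (trunc e n) (Q i - bad i)"
    using bad Q_M[OF i(1)] by (subst plus_emeasure) (auto simp: tm intro!: arg_cong2[where f = emeasure])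
  also have "\<dots> \<le> ennreal (r * (s * avg i powr e * measure M (Q i))) +
      ennreal (4 powr e * avg i powr e * measure M (Q i))"
    by (intro add_mono bd good)
  also have "\<dots> = ennreal ((4 powr e + r * s) * avg i powr e * measure M (Q i))"
    using r s by (subst ennreal_plus[symmetric]) (auto simp: algebra_simps)
  finally show ?thesis .
qed

text \<open>The constant \<open>S = 4\<^sup>e / (1 - r)\<close> is the fixed point of the map \<open>s \<mapsto> 4\<^sup>e + r s\<close> from \<open>bootstrap\<close>. That map contracts
  distances to \<open>S\<close> by the factor \<open>r\<close>, so the excess \<open>s0\<close> of the trivial bound from truncation is
  iterated away.\<close>
lemma truncated_integral_le:
  assumes e: "e > 0" "(2 * C) powr e * (1 - \<theta>) \<le> r" "r < 1"
    and n: "n \<ge> 0" and i: "i \<in> J"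
  shows "emeasure (trunc e n) (Q i) \<le>
    ennreal (4 powr e / (1 - r) * avg i powr e * measure M (Q i))"
proof -
  define S where "S = 4 powr e / (1 - r)"
  define s0 where "s0 = n / avg i powr e"
  have r: "r \<ge> 0" using order_trans[OF _ e(2)] \<theta> by simp
  have S: "S \<ge> 0" "4 powr e + r * S = S" using e by (auto simp: S_def field_simps)
  have s0: "s0 \<ge> 0" using n by (simp add: s0_def)
  have a: "avg i > 0" using avg_pos[OF i] .
  have iter: "emeasure (trunc e n) (Q j) \<le> ennreal ((S + r ^ m * s0) * avg j powr e * measure M (Q j))"
    if "j \<in> J" "avg i \<le> avg j" for j and m :: nat
    using that
  proof (induction m arbitrary: j)
    case 0
    have "emeasure (trunc e n) (Q j) =
        (\<integral>\<^sup>+ x. min (epowr (1 / w x) e) (ennreal n) * indicator (Q j) x \<partial>M)"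
      using Q_M[OF 0(1)] unfolding trunc_def by (intro emeasure_density) auto
    also have "\<dots> \<le> (\<integral>\<^sup>+ x. ennreal n * indicator (Q j) x \<partial>M)"
      by (intro nn_integral_mono mult_right_mono) auto
    also have "\<dots> = ennreal (n * measure M (Q j))"
      using Q_M[OF 0(1)] emeasure_M[OF 0(1)] n by (simp add: nn_integral_cmult_indicator flip: ennreal_mult)
    also have "\<dots> \<le> ennreal ((S + r ^ 0 * s0) * avg j powr e * measure M (Q j))"
    proof (intro ennreal_leI mult_right_mono)
      have "n = s0 * avg i powr e" using a by (simp add: s0_def)
      also have "\<dots> \<le> (S + r ^ 0 * s0) * avg j powr e"
        using S s0 0 a e by (intro mult_mono powr_mono2) auto
      finally show "n \<le> (S + r ^ 0 * s0) * avg j powr e" .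
    qed auto
    finally show ?case .
  next
    case (Suc m)
    have "emeasure (trunc e n) (Q j) \<le>
        ennreal ((4 powr e + r * (S + r ^ m * s0)) * avg j powr e * measure M (Q j))"
      using S r s0 by (intro bootstrap[OF e(1,2) _ Suc.IH Suc.prems]) auto
    also have "4 powr e + r * (S + r ^ m * s0) = S + r ^ Suc m * s0"
      using S(2) by (simp add: distrib_left)
    finally show ?case .
  qed
  have "(\<lambda>m. ennreal ((S + r ^ m * s0) * avg i powr e * measure M (Q i)))
      \<longlonglongrightarrow> ennreal ((S + 0 * s0) * avg i powr e * measure M (Q i))"
    using e r by (intro tendsto_intros LIMSEQ_realpow_zero) auto
  then have "emeasure (trunc e n) (Q i) \<le> ennreal ((S + 0 * s0) * avg i powr e * measure M (Q i))"
    using iter[OF i] by (intro tendsto_lowerbound[where F = sequentially]) auto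
  then show ?thesis by (simp add: S_def)
qed

text \<open>The bound on the truncated integrals does not depend on the height, so monotone convergence
  removes the truncation.\<close>
lemma negative_power_integral_le:
  assumes e: "e > 0" "(2 * C) powr e * (1 - \<theta>) \<le> r" "r < 1" and i: "i \<in> J"
  shows "(\<integral>\<^sup>+ x\<in>Q i. epowr (1 / w x) e \<partial>M) \<le>
    ennreal (4 powr e / (1 - r) * avg i powr e * measure M (Q i))"
proof -
  have sup: "(SUP n. min y (ennreal (real n))) = y" for y :: ennreal
  proof -
    have "(SUP n. min y (ennreal (real n))) = inf y (SUP n. ennreal (real n))"
      unfolding inf_min[symmetric] by (simp add: inf_SUP)
    then show ?thesis by (simp add: ennreal_SUP_of_nat_eq_top flip: ennreal_of_nat_eq_real_of_nat)
  qed
  have "(\<integral>\<^sup>+ x\<in>Q i. epowr (1 / w x) e \<partial>M) =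
      (\<integral>\<^sup>+ x. (SUP n. min (epowr (1 / w x) e) (ennreal (real n)) * indicator (Q i) x) \<partial>M)"
    by (simp add: SUP_mult_right_ennreal[symmetric] sup)
  also have "\<dots> = (SUP n. \<integral>\<^sup>+ x. min (epowr (1 / w x) e) (ennreal (real n)) * indicator (Q i) x \<partial>M)"
    using Q_M[OF i] by (intro nn_integral_monotone_convergence_SUP)
      (auto simp: incseq_def le_fun_def indicator_def intro: min.coboundedI2 ennreal_leI)
  also have "\<dots> = (SUP n. emeasure (trunc e (real n)) (Q i))"
    using Q_M[OF i] unfolding trunc_def by (subst emeasure_density) auto
  also have "\<dots> \<le> ennreal (4 powr e / (1 - r) * avg i powr e * measure M (Q i))"
    by (intro SUP_least truncated_integral_le e i) auto
  finally show ?thesis .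
qed

lemma ex_small_exponent: "\<exists>e>0. (2 * C) powr e * (1 - \<theta>) \<le> 1 - \<theta> / 2"
proof -
  have "((\<lambda>e. (2 * C) powr e * (1 - \<theta>)) \<longlongrightarrow> (2 * C) powr 0 * (1 - \<theta>)) (at_right 0)"
    using C by (intro tendsto_intros) auto
  then have "((\<lambda>e. (2 * C) powr e * (1 - \<theta>)) \<longlongrightarrow> 1 - \<theta>) (at_right 0)"
    using C by simp
  then have "eventually (\<lambda>e. (2 * C) powr e * (1 - \<theta>) < 1 - \<theta> / 2) (at_right 0)"
    using \<theta> by (intro order_tendstoD) auto
  moreover have "eventually (\<lambda>e::real. e > 0) (at_right 0)"
    by (simp add: eventually_at_right_less)
  ultimately have "eventually (\<lambda>e. e > 0 \<and> (2 * C) powr e * (1 - \<theta>) \<le> 1 - \<theta> / 2) (at_right 0)"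
    by eventually_elim auto
  then show ?thesis
    using eventually_happens trivial_limit_at_right_real by blast
qed

text \<open>The exponent \<open>p = 1 + 1 / e\<close> turns \<open>1 / (p - 1)\<close> into \<open>e\<close>. The mean of \<open>w\<close> over \<open>Q i\<close> is \<open>1 / avg i\<close>, which
  cancels the power of \<open>avg i\<close> in \<open>negative_power_integral_le\<close>.\<close>
lemma Muckenhoupt:
  "\<exists>p>1. \<exists>A::real. \<forall>i\<in>J. mean M (Q i) w *
     epowr (mean M (Q i) (\<lambda>x. epowr (1 / w x) (1 / (p - 1)))) (p - 1) \<le> ennreal A"
proof -
  obtain e where e: "e > 0" "(2 * C) powr e * (1 - \<theta>) \<le> 1 - \<theta> / 2"
    using ex_small_exponent by blast
  define S where "S = 4 powr e / (1 - (1 - \<theta> / 2))"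
  have S: "S > 0" using \<theta> by (simp add: S_def)
  have "mean M (Q i) w * epowr (mean M (Q i) (\<lambda>x. epowr (1 / w x) e)) (1 / e)
      \<le> ennreal (S powr (1 / e))" if i: "i \<in> J" for i
  proof -
    have a: "avg i > 0" using avg_pos[OF i] .
    have m: "emeasure M (Q i) = ennreal (measure M (Q i))" using emeasure_M[OF i Q_M[OF i]] by simp
    have "mean M (Q i) w = emeasure N (Q i) / emeasure M (Q i)"
      using Q_M[OF i] by (simp add: mean_def emeasure_density)
    also have "\<dots> = ennreal (measure N (Q i) / measure M (Q i))"
      using emeasure_N[OF i Q_M[OF i]] m M_pos[OF i] by (simp add: divide_ennreal)
    also have "measure N (Q i) / measure M (Q i) = 1 / avg i" by (simp add: avg_def)
    finally have mw: "mean M (Q i) w = ennreal (1 / avg i)" .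
    have "mean M (Q i) (\<lambda>x. epowr (1 / w x) e) \<le>
        ennreal (S * avg i powr e * measure M (Q i)) / ennreal (measure M (Q i))"
      unfolding mean_def m S_def using \<theta>
      by (intro divide_right_mono_ennreal negative_power_integral_le e i) auto
    also have "\<dots> = ennreal (S * avg i powr e)"
      using M_pos[OF i] S by (subst divide_ennreal) auto
    finally have "epowr (mean M (Q i) (\<lambda>x. epowr (1 / w x) e)) (1 / e) \<le>
        epowr (ennreal (S * avg i powr e)) (1 / e)"
      using e by (intro epowr_mono) auto
    also have "\<dots> = ennreal (S powr (1 / e) * avg i)"
      using S a e by (simp add: epowr_ennreal powr_mult powr_powr)
    finally have "mean M (Q i) w * epowr (mean M (Q i) (\<lambda>x. epowr (1 / w x) e)) (1 / e) \<le>
        ennreal (1 / avg i) * ennreal (S powr (1 / e) * avg i)"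
      unfolding mw by (rule mult_left_mono) simp
    also have "\<dots> = ennreal (S powr (1 / e))"
      using a by (simp flip: ennreal_mult)
    finally show ?thesis .
  qed
  then show ?thesis
    using e by (intro exI[of _ "1 + 1 / e"]) auto
qed

end

section \<open>Dyadic cubes in spaces of homogeneous type\<close>

lemma open_in_qborel: "openin (qtopology X \<rho>) U \<Longrightarrow> U \<in> sets (qborel X \<rho>)"
  unfolding qborel_def by (subst sets_measure_of) (auto simp: openin_qtopology)

lemma emeasure_qball:
  assumes "homogeneous_type M \<rho> A0" "x \<in> space M" "r > 0"
  shows "qball (space M) \<rho> x r \<in> sets M" "emeasure M (qball (space M) \<rho> x r) > 0"
    "emeasure M (qball (space M) \<rho> x r) < \<infinity>"
proof -
  have dm: "doubling_measure M \<rho>" using assms(1) by (simp add: homogeneous_type_def)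
  then obtain A1 :: real where A1: "A1 \<ge> 1" and A: "\<And>x r. x \<in> space M \<Longrightarrow> r > 0 \<Longrightarrow>
        0 < emeasure M (qball (space M) \<rho> x (2 * r)) \<and>
        ennreal A1 * emeasure M (qball (space M) \<rho> x r) < \<infinity>"
    unfolding doubling_measure_def by blast
  show "qball (space M) \<rho> x r \<in> sets M" using dm assms(2,3) by (simp add: doubling_measure_def)
  show "emeasure M (qball (space M) \<rho> x r) > 0" using A[OF assms(2), of "r / 2"] assms(3) by simp
  have "emeasure M (qball (space M) \<rho> x r) \<le> ennreal A1 * emeasure M (qball (space M) \<rho> x r)"
    using mult_right_mono[of 1 "ennreal A1" "emeasure M (qball (space M) \<rho> x r)"] A1 by simp
  also have "\<dots> < \<infinity>" using A[OF assms(2,3)] by simp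
  finally show "emeasure M (qball (space M) \<rho> x r) < \<infinity>" .
qed

text \<open>Cubes of generation \<open>l\<close> have diameter at most \<open>2 A0 C1 \<delta>\<^sup>l\<close>, so they shrink to points.\<close>
lemma ex_cube_in_open:
  assumes qm: "quasimetric_on X \<rho> A0" and D: "dyadic_system X \<rho> \<delta> c1 C1 D"
    and U: "openin (qtopology X \<rho>) U" "x \<in> U"
  shows "\<exists>l\<ge>k. \<exists>\<gamma>\<in>idx D l. x \<in> cube D l \<gamma> \<and> cube D l \<gamma> \<subseteq> U"
proof -
  from U obtain r where r: "r > 0" "qball X \<rho> x r \<subseteq> U" and x: "x \<in> X"
    unfolding openin_qtopology by blast
  have A0: "A0 \<ge> 1" using qm by (simp add: quasimetric_on_def)
  have \<delta>: "0 < \<delta>" "\<delta> < 1" using D by (simp_all add: dyadic_system_def)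
  have "(\<lambda>n. 2 * A0 * C1 * \<delta> powi k * \<delta> ^ n) \<longlonglongrightarrow> 2 * A0 * C1 * \<delta> powi k * 0"
    using \<delta> by (intro tendsto_intros LIMSEQ_realpow_zero) auto
  then have "eventually (\<lambda>n. 2 * A0 * C1 * \<delta> powi k * \<delta> ^ n < r) sequentially"
    using r by (intro order_tendstoD(2)[of _ "2 * A0 * C1 * \<delta> powi k * 0"]) auto
  then obtain n where n: "2 * A0 * C1 * \<delta> powi k * \<delta> ^ n < r"
    by (auto simp: eventually_sequentially)
  define l where "l = k + int n"
  have l: "2 * A0 * C1 * \<delta> powi l < r"
    using n \<delta> by (simp add: l_def power_int_add mult_ac)
  have "(\<Union>\<gamma>\<in>idx D l. cube D l \<gamma>) = X" using D by (simp add: dyadic_system_def)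
  with x obtain \<gamma> where \<gamma>: "\<gamma> \<in> idx D l" "x \<in> cube D l \<gamma>" by blast
  have ball: "cube D l \<gamma> \<subseteq> qball X \<rho> (center D l \<gamma>) (C1 * \<delta> powi l)"
    and cen: "center D l \<gamma> \<in> cube D l \<gamma>"
    using D \<gamma>(1) by (simp_all add: dyadic_system_def cube_ball_def)
  from ball cen have cX: "center D l \<gamma> \<in> X" by (auto simp: qball_def)
  have "cube D l \<gamma> \<subseteq> qball X \<rho> x r"
  proof
    fix y assume "y \<in> cube D l \<gamma>"
    with ball \<gamma>(2) have y: "y \<in> X" "\<rho> (center D l \<gamma>) y < C1 * \<delta> powi l"
      "\<rho> (center D l \<gamma>) x < C1 * \<delta> powi l"
      by (auto simp: qball_def)
    have "\<rho> x y \<le> A0 * \<rho> x (center D l \<gamma>) + A0 * \<rho> (center D l \<gamma>) y"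
      "\<rho> x (center D l \<gamma>) = \<rho> (center D l \<gamma>) x"
      using qm x y(1) cX unfolding quasimetric_on_def by blast+
    moreover have "A0 * \<rho> (center D l \<gamma>) x \<le> A0 * (C1 * \<delta> powi l)"
      "A0 * \<rho> (center D l \<gamma>) y \<le> A0 * (C1 * \<delta> powi l)"
      using y A0 by (intro mult_left_mono; simp)+
    ultimately have "\<rho> x y < r" using l by simp
    with y show "y \<in> qball X \<rho> x r" by (simp add: qball_def)
  qed
  with r \<gamma> show ?thesis by (intro exI[of _ l]) (auto simp: l_def)
qed

abbreviation cube_indices :: "('a, 'i) cube_family \<Rightarrow> (int \<times> 'i) set" where
  "cube_indices D \<equiv> SIGMA k:UNIV. idx D k"

abbreviation indexed_cube :: "('a, 'i) cube_family \<Rightarrow> int \<times> 'i \<Rightarrow> 'a set" where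
  "indexed_cube D i \<equiv> cube D (fst i) (snd i)"

text \<open>Cubes are sandwiched between balls, hence have positive finite measure. The covering property
  combines outer regularity with the fact that the subcubes of a cube that lie in an open set
  exhaust the part of the open set inside the cube.\<close>
lemma dyadic_grid_cubes:
  assumes hom: "homogeneous_type M \<rho> A0" and reg: "borel_regular M \<rho>"
    and D: "dyadic_system (space M) \<rho> \<delta> c1 C1 D"
  shows "dyadic_grid M (qborel (space M) \<rho>) (cube_indices D) fst (indexed_cube D)"
proof
  let ?B = "qborel (space M) \<rho>"
  have qm: "quasimetric_on (space M) \<rho> A0" and BM: "sets ?B \<subseteq> sets M"
    using hom by (simp_all add: homogeneous_type_def)
  have \<delta>: "0 < \<delta>" and c: "0 < c1" "c1 < C1" using D by (simp_all add: dyadic_system_def)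
  have nest: "cube D l \<gamma> \<subseteq> cube D k \<beta> \<or> cube D k \<beta> \<inter> cube D l \<gamma> = {}"
    if "\<beta> \<in> idx D k" "\<gamma> \<in> idx D l" "k \<le> l" for k l \<beta> \<gamma>
    using D that by (simp add: dyadic_system_def)
  have cubeB: "cube D k \<beta> \<in> sets ?B" and cen: "center D k \<beta> \<in> cube D k \<beta>"
    and balls: "qball (space M) \<rho> (center D k \<beta>) (c1 * \<delta> powi k) \<subseteq> cube D k \<beta>"
      "cube D k \<beta> \<subseteq> qball (space M) \<rho> (center D k \<beta>) (C1 * \<delta> powi k)"
    if "\<beta> \<in> idx D k" for k \<beta>
    using D that by (simp_all add: dyadic_system_def cube_ball_def)
  have cenX: "center D k \<beta> \<in> space M" if "\<beta> \<in> idx D k" for k \<beta>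
    using cen[OF that] balls(2)[OF that] by (auto simp: qball_def)
  have rad: "c1 * \<delta> powi k > 0" "C1 * \<delta> powi k > 0" for k using \<delta> c by simp_all
  show "sets ?B \<subseteq> sets M" by (fact BM)
  show "countable (cube_indices D)"
    using D by (intro countable_SIGMA) (auto simp: dyadic_system_def)
  show cB: "indexed_cube D i \<in> sets ?B" if "i \<in> cube_indices D" for i
    using that cubeB by auto
  show "indexed_cube D j \<subseteq> indexed_cube D i"
    if "i \<in> cube_indices D" "j \<in> cube_indices D" "fst i \<le> fst j"
      "indexed_cube D i \<inter> indexed_cube D j \<noteq> {}" for i j
    using that nest[of "snd i" "fst i" "snd j" "fst j"] by auto
  show "i = j"
    if "i \<in> cube_indices D" "j \<in> cube_indices D" "fst i = fst j"
      "indexed_cube D i \<inter> indexed_cube D j \<noteq> {}" for i j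
  proof -
    have "disjoint_family_on (cube D (fst j)) (idx D (fst j))"
      using D by (simp add: dyadic_system_def)
    with that have "snd i = snd j"
      unfolding disjoint_family_on_def by (metis SigmaE fst_conv snd_conv)
    with that show ?thesis by (simp add: prod_eq_iff)
  qed
  show "\<exists>i\<in>cube_indices D. fst j = fst i + 1 \<and> indexed_cube D j \<subseteq> indexed_cube D i"
    if "j \<in> cube_indices D" for j
  proof -
    have "\<forall>k l. \<forall>\<beta>\<in>idx D k. l \<le> k \<longrightarrow> (\<exists>!\<gamma>. \<gamma> \<in> idx D l \<and> cube D k \<beta> \<subseteq> cube D l \<gamma>)"
      using D unfolding dyadic_system_def by (elim conjE)
    moreover have "snd j \<in> idx D (fst j)" "fst j - 1 \<le> fst j" using that by auto
    ultimately obtain \<gamma> where "\<gamma> \<in> idx D (fst j - 1)" "cube D (fst j) (snd j) \<subseteq> cube D (fst j - 1) \<gamma>"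
      by blast
    then show ?thesis by (intro bexI[of _ "(fst j - 1, \<gamma>)"]) auto
  qed
  show "emeasure M (indexed_cube D i) > 0" if i: "i \<in> cube_indices D" for i
  proof -
    have "0 < emeasure M (qball (space M) \<rho> (center D (fst i) (snd i)) (c1 * \<delta> powi fst i))"
      using i cenX rad by (intro emeasure_qball[OF hom]) auto
    also have "\<dots> \<le> emeasure M (indexed_cube D i)"
      using i balls(1)[of "snd i" "fst i"] cB[OF i] BM by (intro emeasure_mono) auto
    finally show ?thesis .
  qed
  show fin: "emeasure M (indexed_cube D i) < \<infinity>" if i: "i \<in> cube_indices D" for i
  proof -
    have "emeasure M (indexed_cube D i) \<le>
        emeasure M (qball (space M) \<rho> (center D (fst i) (snd i)) (C1 * \<delta> powi fst i))"
      using i balls(2)[of "snd i" "fst i"] cenX rad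
      by (intro emeasure_mono emeasure_qball[OF hom]) auto
    also have "\<dots> < \<infinity>" using i cenX rad by (intro emeasure_qball[OF hom]) auto
    finally show ?thesis .
  qed
  show "\<exists>G. G \<subseteq> {j \<in> cube_indices D. fst i \<le> fst j \<and> indexed_cube D j \<subseteq> indexed_cube D i} \<and>
        E \<subseteq> \<Union> (indexed_cube D ` G) \<and>
        emeasure M (\<Union> (indexed_cube D ` G)) \<le> emeasure M E + ennreal d"
    if i: "i \<in> cube_indices D" and E: "E \<in> sets ?B" "E \<subseteq> indexed_cube D i" and d: "d > 0" for i E d
  proof -
    have "emeasure M E < \<infinity>"
      using emeasure_mono[OF E(2), of M] cB[OF i] BM fin[OF i] by auto
    then have lt: "emeasure M E < emeasure M E + ennreal d" using d by simp
    have "emeasure M E = (INF U\<in>{U. openin (qtopology (space M) \<rho>) U \<and> E \<subseteq> U}. emeasure M U)"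
      using reg E(1) by (auto simp: borel_regular_def)
    with lt obtain U where U: "openin (qtopology (space M) \<rho>) U" "E \<subseteq> U"
        "emeasure M U < emeasure M E + ennreal d"
      by (metis (mono_tags, lifting) INF_less_iff mem_Collect_eq)
    define G where "G = {j \<in> cube_indices D. fst i \<le> fst j \<and>
      indexed_cube D j \<subseteq> indexed_cube D i \<and> indexed_cube D j \<subseteq> U}"
    have "E \<subseteq> \<Union> (indexed_cube D ` G)"
    proof
      fix x assume x: "x \<in> E"
      with U ex_cube_in_open[OF qm D U(1), of x "fst i"] obtain l \<gamma>
        where l: "fst i \<le> l" "\<gamma> \<in> idx D l" "x \<in> cube D l \<gamma>" "cube D l \<gamma> \<subseteq> U"
        by blast
      moreover have "cube D l \<gamma> \<subseteq> indexed_cube D i"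
      proof -
        have "snd i \<in> idx D (fst i)" "x \<in> indexed_cube D i" using i x E(2) by auto
        then show ?thesis using nest[of "snd i" "fst i" \<gamma> l] l by blast
      qed
      ultimately have "(l, \<gamma>) \<in> G" by (simp add: G_def)
      with l(3) show "x \<in> \<Union> (indexed_cube D ` G)" by force
    qed
    moreover have "emeasure M (\<Union> (indexed_cube D ` G)) \<le> emeasure M U"
      using U(1) open_in_qborel BM by (intro emeasure_mono) (auto simp: G_def)
    with U(3) have "emeasure M (\<Union> (indexed_cube D ` G)) \<le> emeasure M E + ennreal d"
      by simp
    ultimately show ?thesis by (intro exI[of _ G]) (auto simp: G_def)
  qed
qed

text \<open>Doubling controls a cube through its children, so the positivity and finiteness of the weight on
  every cube depend on each cube having at least one child.\<close>
lemma dyadic_doublingD: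
  assumes D: "dyadic_system X \<rho> \<delta> c1 C1 D" and dbl: "dyadic_doubling M D w"
    and w: "w \<in> borel_measurable M"
    and cM: "\<And>k \<beta>. \<beta> \<in> idx D k \<Longrightarrow> cube D k \<beta> \<in> sets M"
  obtains C :: real where "C \<ge> 1"
    and "\<And>k \<beta>. \<beta> \<in> idx D k \<Longrightarrow> 0 < emeasure (density M w) (cube D k \<beta>)"
    and "\<And>k \<beta>. \<beta> \<in> idx D k \<Longrightarrow> emeasure (density M w) (cube D k \<beta>) < \<infinity>"
    and "\<And>k \<beta> \<gamma>. \<beta> \<in> idx D k \<Longrightarrow> \<gamma> \<in> children D k \<beta> \<Longrightarrow>
      measure (density M w) (cube D k \<beta>) \<le> C * measure (density M w) (cube D (k + 1) \<gamma>)"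
proof -
  let ?N = "density M w"
  have N: "(\<integral>\<^sup>+ x\<in>cube D k \<beta>. w x \<partial>M) = emeasure ?N (cube D k \<beta>)" if "\<beta> \<in> idx D k" for k \<beta>
    using w cM[OF that] by (simp add: emeasure_density)
  from dbl obtain c :: real where c: "\<And>k \<beta> \<gamma>. \<beta> \<in> idx D k \<Longrightarrow> \<gamma> \<in> children D k \<beta> \<Longrightarrow>
     0 < (\<integral>\<^sup>+ x\<in>cube D k \<beta>. w x \<partial>M) \<and>
     (\<integral>\<^sup>+ x\<in>cube D k \<beta>. w x \<partial>M) \<le> ennreal c * (\<integral>\<^sup>+ x\<in>cube D (k + 1) \<gamma>. w x \<partial>M) \<and>
     ennreal c * (\<integral>\<^sup>+ x\<in>cube D (k + 1) \<gamma>. w x \<partial>M) < \<infinity>"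
    unfolding dyadic_doubling_def by blast
  have child: "\<exists>\<gamma>. \<gamma> \<in> children D k \<beta>" if "\<beta> \<in> idx D k" for k \<beta>
  proof -
    have "1 \<le> card (children D k \<beta>)" using D that unfolding dyadic_system_def by blast
    then show ?thesis by (metis card.empty ex_in_conv not_one_le_zero)
  qed
  have pos: "0 < emeasure ?N (cube D k \<beta>)" if b: "\<beta> \<in> idx D k" for k \<beta>
    using child[OF b] c[OF b] N[OF b] by auto
  have fin: "emeasure ?N (cube D k \<beta>) < \<infinity>" if b: "\<beta> \<in> idx D k" for k \<beta>
  proof -
    from child[OF b] obtain \<gamma> where "\<gamma> \<in> children D k \<beta>" by blast
    from c[OF b this] show ?thesis unfolding N[OF b] using le_less_trans by blast
  qed
  have "measure ?N (cube D k \<beta>) \<le> max 1 c * measure ?N (cube D (k + 1) \<gamma>)"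
    if b: "\<beta> \<in> idx D k" and g: "\<gamma> \<in> children D k \<beta>" for k \<beta> \<gamma>
  proof -
    from g have g': "\<gamma> \<in> idx D (k + 1)" by (simp add: children_def)
    have m: "emeasure ?N (cube D k \<beta>) = ennreal (measure ?N (cube D k \<beta>))"
      "emeasure ?N (cube D (k + 1) \<gamma>) = ennreal (measure ?N (cube D (k + 1) \<gamma>))"
      using fin[OF b] fin[OF g'] by (simp_all add: emeasure_eq_ennreal_measure)
    have "emeasure ?N (cube D k \<beta>) \<le> ennreal c * emeasure ?N (cube D (k + 1) \<gamma>)"
      using c[OF b g] by (simp add: N b g')
    also have "\<dots> \<le> ennreal (max 1 c) * emeasure ?N (cube D (k + 1) \<gamma>)"
      by (intro mult_right_mono ennreal_leI) auto
    finally show ?thesis unfolding m by (simp flip: ennreal_mult)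
  qed
  with pos fin show ?thesis by (intro that[of "max 1 c"]) auto
qed

text \<open>Raised to the power \<open>q\<close> and cleared of denominators, the reverse Hoelder inequality involves only
  finite numbers once the cube has positive finite measure and weight.\<close>
lemma RH_dyadicD:
  assumes RH: "RH_dyadic M D q w" and q: "q > 1" and w [measurable]: "w \<in> borel_measurable M"
  obtains K :: real where "K \<ge> 1"
    and "\<And>k \<beta>. \<beta> \<in> idx D k \<Longrightarrow> cube D k \<beta> \<in> sets M \<Longrightarrow>
      0 < emeasure M (cube D k \<beta>) \<Longrightarrow> emeasure M (cube D k \<beta>) < \<infinity> \<Longrightarrow>
      0 < emeasure (density M w) (cube D k \<beta>) \<Longrightarrow> emeasure (density M w) (cube D k \<beta>) < \<infinity> \<Longrightarrow>
      emeasure (density M (\<lambda>x. epowr (w x) q)) (cube D k \<beta>) \<le>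
      ennreal (K * (measure (density M w) (cube D k \<beta>) / measure M (cube D k \<beta>)) powr q *
        measure M (cube D k \<beta>))"
proof -
  define s where "s = (SUP k. SUP \<beta>\<in>idx D k.
        epowr (mean M (cube D k \<beta>) (\<lambda>x. epowr (w x) q)) (1 / q) *
        inverse (mean M (cube D k \<beta>) w))"
  define K where "K = max 1 (enn2real s)"
  have "s < \<infinity>"
    using RH unfolding RH_dyadic_def s_def by (rule conjunct2)
  then have "s = ennreal (enn2real s)" by simp
  also have "\<dots> \<le> ennreal K" unfolding K_def by (intro ennreal_leI) simp
  finally have s: "s \<le> ennreal K" .
  have "emeasure (density M (\<lambda>x. epowr (w x) q)) P \<le>
      ennreal (K powr q * (measure (density M w) P / measure M P) powr q * measure M P)"
    if b: "\<beta> \<in> idx D k" and P: "P = cube D k \<beta>" and [measurable]: "P \<in> sets M"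
      and M: "0 < emeasure M P" "emeasure M P < \<infinity>"
      and N: "0 < emeasure (density M w) P" "emeasure (density M w) P < \<infinity>" for k \<beta> P
  proof -
    define m where "m = measure (density M w) P / measure M P"
    have eM: "emeasure M P = ennreal (measure M P)" "measure M P > 0"
      using M emeasure_eq_ennreal_measure[of M P] enn2real_positive_iff[of "emeasure M P"]
      by (auto simp flip: measure_def)
    have eN: "emeasure (density M w) P = ennreal (measure (density M w) P)"
        "measure (density M w) P > 0"
      using N emeasure_eq_ennreal_measure[of "density M w" P]
        enn2real_positive_iff[of "emeasure (density M w) P"]
      by (auto simp flip: measure_def)
    have m: "m > 0" using eM eN by (simp add: m_def)
    have "mean M P w = emeasure (density M w) P / emeasure M P"
      by (simp add: mean_def emeasure_density)
    then have mw: "mean M P w = ennreal m"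
      using eM eN by (simp add: m_def divide_ennreal)
    define h where "h = mean M P (\<lambda>x. epowr (w x) q)"
    have "epowr h (1 / q) * inverse (mean M P w) \<le> s"
      unfolding s_def h_def P using b by (intro SUP_upper2[of k] SUP_upper2[of \<beta>]) auto
    with s have "epowr h (1 / q) * inverse (ennreal m) \<le> ennreal K" by (simp add: mw)
    then have "epowr h (1 / q) * inverse (ennreal m) * ennreal m \<le> ennreal K * ennreal m"
      by (rule mult_right_mono) simp
    moreover have "inverse (ennreal m) * ennreal m = 1"
      using m by (simp add: inverse_ennreal flip: ennreal_mult)
    ultimately have "epowr h (1 / q) \<le> ennreal (K * m)"
      using m by (simp add: mult.assoc K_def flip: ennreal_mult)
    then have "h \<le> ennreal ((K * m) powr q)"
      using q m by (intro le_powr_of_epowr_le) (auto simp: K_def)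
    then have "h * emeasure M P \<le> ennreal ((K * m) powr q) * emeasure M P"
      by (rule mult_right_mono) simp
    moreover have "h * emeasure M P = emeasure (density M (\<lambda>x. epowr (w x) q)) P"
      using M by (simp add: h_def mean_def emeasure_density ennreal_divide_times
          ennreal_times_divide[symmetric] mult_divide_eq_ennreal)
    ultimately show ?thesis
      using m eM by (simp add: powr_mult K_def flip: ennreal_mult m_def)
  qed
  moreover have "K powr q \<ge> 1" using q by (intro ge_one_powr_ge_zero) (auto simp: K_def)
  ultimately show ?thesis by (intro that[of "K powr q"]) auto
qed

theorem theorem3p8:
  fixes M :: "'a measure" and \<rho> :: "'a \<Rightarrow> 'a \<Rightarrow> real" and A0 \<delta> q :: real
    and T :: nat and Ds :: "nat \<Rightarrow> ('a, 'i) cube_family" and D :: "('a, 'i) cube_family"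
    and w :: "'a \<Rightarrow> ennreal"
  assumes "homogeneous_type M \<rho> A0"
    and "borel_regular M \<rho>"
    and "adjacent_dyadic_systems (space M) \<rho> A0 \<delta> T Ds"
    and "D \<in> Ds ` {1..T}"
    and "weight M \<rho> w"
    and "q > 1"
    and "RH_dyadic M D q w"
  shows "\<exists>p>1. A_dyadic M D p w"
proof -
  have D: "dyadic_system (space M) \<rho> \<delta> (1 / (12 * A0 ^ 4)) (4 * A0\<^sup>2) D"
    using assms(3,4) by (auto simp: adjacent_dyadic_systems_def)
  interpret grid: dyadic_grid M "qborel (space M) \<rho>" "cube_indices D" fst "indexed_cube D"
    by (rule dyadic_grid_cubes[OF assms(1,2) D])
  have w: "w \<in> borel_measurable M" using assms(5) by (simp add: weight_def)
  obtain g where g: "g \<in> borel_measurable (qborel (space M) \<rho>)" "AE x in M. w x = g x"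
    using assms(5) by (auto simp: weight_def)
  have cM: "cube D k \<beta> \<in> sets M" if "\<beta> \<in> idx D k" for k \<beta>
    using grid.Q_M[of "(k, \<beta>)"] that by simp
  obtain C where C: "C \<ge> 1"
    "\<And>k \<beta>. \<beta> \<in> idx D k \<Longrightarrow> 0 < emeasure (density M w) (cube D k \<beta>)"
    "\<And>k \<beta>. \<beta> \<in> idx D k \<Longrightarrow> emeasure (density M w) (cube D k \<beta>) < \<infinity>"
    "\<And>k \<beta> \<gamma>. \<beta> \<in> idx D k \<Longrightarrow> \<gamma> \<in> children D k \<beta> \<Longrightarrow>
      measure (density M w) (cube D k \<beta>) \<le> C * measure (density M w) (cube D (k + 1) \<gamma>)"
    using assms(7) by (auto simp: RH_dyadic_def intro: dyadic_doublingD[OF D _ w cM])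
  obtain K where K: "K \<ge> 1"
    "\<And>k \<beta>. \<beta> \<in> idx D k \<Longrightarrow> cube D k \<beta> \<in> sets M \<Longrightarrow>
      0 < emeasure M (cube D k \<beta>) \<Longrightarrow> emeasure M (cube D k \<beta>) < \<infinity> \<Longrightarrow>
      0 < emeasure (density M w) (cube D k \<beta>) \<Longrightarrow> emeasure (density M w) (cube D k \<beta>) < \<infinity> \<Longrightarrow>
      emeasure (density M (\<lambda>x. epowr (w x) q)) (cube D k \<beta>) \<le>
      ennreal (K * (measure (density M w) (cube D k \<beta>) / measure M (cube D k \<beta>)) powr q *
        measure M (cube D k \<beta>))"
    by (rule RH_dyadicD[OF assms(7,6) w]) (rule that; assumption)
  interpret rh_weight M "qborel (space M) \<rho>" "cube_indices D" fst "indexed_cube D" w g C q K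
  proof
    fix i assume i: "i \<in> cube_indices D"
    then have i': "snd i \<in> idx D (fst i)" by auto
    show "0 < emeasure (density M w) (indexed_cube D i)"
      "emeasure (density M w) (indexed_cube D i) < \<infinity>"
      using C(2,3)[OF i'] by auto
    show "emeasure (density M (\<lambda>x. epowr (w x) q)) (indexed_cube D i) \<le>
      ennreal (K * (measure (density M w) (indexed_cube D i) / measure M (indexed_cube D i)) powr q *
        measure M (indexed_cube D i))"
      by (rule K(2)[OF i' cM[OF i'] grid.pos[OF i] grid.fin[OF i] C(2,3)[OF i']])
    fix j assume "j \<in> cube_indices D" "fst j = fst i + 1" "indexed_cube D j \<subseteq> indexed_cube D i"
    then show "measure (density M w) (indexed_cube D i) \<le> C * measure (density M w) (indexed_cube D j)"
      using C(4)[OF i', of "snd j"] by (auto simp: children_def)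
  qed (use w g C(1) K(1) assms(6) in auto)
  from Muckenhoupt obtain p A where "p > 1" and A: "\<And>i. i \<in> cube_indices D \<Longrightarrow>
      mean M (indexed_cube D i) w *
      epowr (mean M (indexed_cube D i) (\<lambda>x. epowr (1 / w x) (1 / (p - 1)))) (p - 1) \<le> ennreal A"
    by blast
  have "(SUP k. SUP \<beta>\<in>idx D k. mean M (cube D k \<beta>) w *
      epowr (mean M (cube D k \<beta>) (\<lambda>x. epowr (1 / w x) (1 / (p - 1)))) (p - 1)) \<le> ennreal A"
    using A[of "(_, _)"] by (intro SUP_least) auto
  then have "A_dyadic M D p w"
    unfolding A_dyadic_def by (rule le_less_trans) simp
  with \<open>p > 1\<close> show ?thesis by blast
qed

end
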